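(* Let $n$ be a positive integer. For generic $x,y\in\mathbb{C}^*$, \[ f_{n,n+1,n}(x,y,q)=g_{n,n+1,n}(x,y,q,y^n/x^n,x^n/y^n). \]
   Context: Let $q\in\mathbb{C}$ with $0<|q|<1$. $j(x;q):=(x;q)_\infty(q/x;q)_\infty(q;q)_\infty=\sum_{n\in\mathbb{Z}}(-1)^nq^{\binom n2}x^n$. Appell–Lerch sum: $m(x,q,z):=\frac{1}{j(z;q)}\sum_{r\in\mathbb{Z}}\frac{(-1)^rq^{\binom r2}z^r}{1-q^{r-1}xz}$. With $\mathrm{sg}(r)=1$ for $r\ge0$, $-1$ for $r<0$: $f_{a,b,c}(x,y,q):=\sum_{\mathrm{sg}(r)=\mathrm{sg}(s)}\mathrm{sg}(r)(-1)^{r+s}x^ry^sq^{a\binom r2+brs+c\binom s2}$, and \begin{align*} g_{a,b,c}(x,y,q,z_1,z_0):=&\sum_{t=0}^{a-1}(-y)^tq^{c\binom t2}j(q^{bt}x;q^a)\,m\Big(-q^{a\binom{b+1}{2}-c\binom{a+1}{2}-t(b^2-ac)}\frac{(-y)^a}{(-x)^b},q^{a(b^2-ac)},z_0\Big)\\ &+\sum_{t=0}^{c-1}(-x)^tq^{a\binom t2}j(q^{bt}y;q^c)\,m\Big(-q^{c\binom{b+1}{2}-a\binom{c+1}{2}-t(b^2-ac)}\frac{(-x)^c}{(-y)^b},q^{c(b^2-ac)},z_1\Big). \end{align*} "Generic" means no pole occurs in the Appell–Lerch sums. *)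

theory Defs
  imports "HOL-Analysis.Analysis"
begin

definition binom2 :: "int \<Rightarrow> int" where
  "binom2 r = r * (r - 1) div 2"

definition qpoch_inf :: "complex \<Rightarrow> complex \<Rightarrow> complex" where
  "qpoch_inf x q = (\<Prod>k. 1 - x * q ^ k)"

definition jtheta :: "complex \<Rightarrow> complex \<Rightarrow> complex" where
  "jtheta x q = qpoch_inf x q * qpoch_inf (q / x) q * qpoch_inf q q"

definition appell_lerch :: "complex \<Rightarrow> complex \<Rightarrow> complex \<Rightarrow> complex" where
  "appell_lerch x q z =
     1 / jtheta z q *
     (\<Sum>\<^sub>\<infinity>r::int. (-1) powi r * q powi (binom2 r) * z powi r / (1 - q powi (r - 1) * x * z))"

text \<open>The sum \<^term>\<open>appell_lerch x q z\<close> has no pole: neither the theta function in front nor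
  any denominator of a summand vanishes.\<close>

definition appell_lerch_no_pole :: "complex \<Rightarrow> complex \<Rightarrow> complex \<Rightarrow> bool" where
  "appell_lerch_no_pole x q z \<longleftrightarrow>
     jtheta z q \<noteq> 0 \<and> (\<forall>r::int. 1 - q powi (r - 1) * x * z \<noteq> 0)"

definition sg :: "int \<Rightarrow> int" where
  "sg r = (if r \<ge> 0 then 1 else -1)"

definition hecke_f :: "nat \<Rightarrow> nat \<Rightarrow> nat \<Rightarrow> complex \<Rightarrow> complex \<Rightarrow> complex \<Rightarrow> complex" where
  "hecke_f a b c x y q =
     (\<Sum>\<^sub>\<infinity>(r, s)\<in>{(r, s). sg r = sg s}.
        of_int (sg r) * (-1) powi (r + s) * x powi r * y powi s *
        q powi (int a * binom2 r + int b * r * s + int c * binom2 s))"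

text \<open>The first argument of the Appell--Lerch sum in the \<open>t\<close>-th term of the first sum
  of \<open>g\<^bsub>a,b,c\<^esub>(x, y, q, z\<^sub>1, z\<^sub>0)\<close>.  The one in the second sum arises by exchanging
  \<open>a\<close> with \<open>c\<close> and \<open>x\<close> with \<open>y\<close>.\<close>

definition g_arg :: "nat \<Rightarrow> nat \<Rightarrow> nat \<Rightarrow> complex \<Rightarrow> complex \<Rightarrow> complex \<Rightarrow> nat \<Rightarrow> complex" where
  "g_arg a b c x y q t =
     - (q powi (int a * int ((b + 1) choose 2) - int c * int ((a + 1) choose 2)
                - int t * ((int b)\<^sup>2 - int a * int c)) *
        ((- y) ^ a / (- x) ^ b))"

definition appell_g ::
  "nat \<Rightarrow> nat \<Rightarrow> nat \<Rightarrow> complex \<Rightarrow> complex \<Rightarrow> complex \<Rightarrow> complex \<Rightarrow> complex \<Rightarrow> complex" where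
  "appell_g a b c x y q z1 z0 =
     (\<Sum>t<a. (- y) ^ t * q ^ (c * (t choose 2)) * jtheta (q ^ (b * t) * x) (q ^ a) *
        appell_lerch (g_arg a b c x y q t) (q powi (int a * ((int b)\<^sup>2 - int a * int c))) z0) +
     (\<Sum>t<c. (- x) ^ t * q ^ (a * (t choose 2)) * jtheta (q ^ (b * t) * y) (q ^ c) *
        appell_lerch (g_arg c b a y x q t) (q powi (int c * ((int b)\<^sup>2 - int a * int c))) z1)"

definition appell_g_generic ::
  "nat \<Rightarrow> nat \<Rightarrow> nat \<Rightarrow> complex \<Rightarrow> complex \<Rightarrow> complex \<Rightarrow> complex \<Rightarrow> complex \<Rightarrow> bool" where
  "appell_g_generic a b c x y q z1 z0 \<longleftrightarrow>
     (\<forall>t<a. appell_lerch_no_pole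
        (g_arg a b c x y q t) (q powi (int a * ((int b)\<^sup>2 - int a * int c))) z0) \<and>
     (\<forall>t<c. appell_lerch_no_pole
        (g_arg c b a y x q t) (q powi (int c * ((int b)\<^sup>2 - int a * int c))) z1)"

end

theory Submission
  imports Defs
begin

text \<open>
  Put \<open>Q = q\<^bsup>n(2n+1)\<^esup>\<close> and \<open>z\<^sub>0 = x\<^sup>n/y\<^sup>n\<close>.  The series of \<open>j(z\<^sub>0;Q) f\<close>, \<open>f = f\<^bsub>n,n+1,n\<^esub>(x,y,q)\<close>, consists
  of terms \<open>T(A,B,p)\<close>, a monomial \<open>x\<^sup>A y\<^sup>B\<close> times a signed power of \<open>q\<close>, with weight
  \<open>[np \<ge> -B] + [np \<le> A] - 1\<close>.  For this choice of \<open>z\<^sub>0\<close> the denominators of the first half of \<open>g\<close> are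
  \<open>1 - u\<^sub>B\<close> with \<open>u\<^sub>B = q\<^bsup>-(2n+1)B-n\<^sup>2\<^esup>/x\<close>, and the pairs of summation indices \<open>(t,r)\<close> correspond to the
  integers \<open>B = t - nr\<close>.  Multiplication by \<open>u\<^sub>B\<close> maps \<open>T(A,B,p)\<close> to \<open>T(A-1,B,p+1)\<close>, while
  \<open>\<Sum>\<^sub>p T(A,B,p) = 0\<close> by the reflection of a theta series.  Hence, by telescoping, \<open>j(z\<^sub>0;Q)\<close> times
  the first half of \<open>g\<close> is the sum of the \<open>T(A,B,p)\<close> with weight \<open>[np \<ge> -B] - [A \<le> B + c]\<close>, for any \<open>c\<close>;
  the second term makes the sum absolutely convergent.  The symmetry \<open>(A,B,p) \<mapsto> (B+n,A-n,1-p)\<close>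
  exchanging \<open>x\<close> and \<open>y\<close> turns the second half of \<open>g\<close> into the sum with weight \<open>[np \<le> A] - [A > B]\<close>,
  and for \<open>c = 0\<close> the two weights add up to that of \<open>j(z\<^sub>0;Q) f\<close>.
\<close>

section \<open>Theta series and the Jacobi triple product\<close>

lemma binom2_double: "2 * binom2 r = r * (r - 1)"
  by (simp add: binom2_def)

lemma binom2_add: "binom2 (r + s) = binom2 r + binom2 s + r * s"
proof -
  have "2 * binom2 (r + s) = 2 * (binom2 r + binom2 s + r * s)"
    by (simp only: distrib_left binom2_double) (simp add: algebra_simps)
  thus ?thesis by simp
qed

lemma binom2_simps [simp]: "binom2 0 = 0" "binom2 1 = 0" "binom2 (-1) = 1"
  by (simp_all add: binom2_def)

lemma binom2_Suc: "binom2 (int (Suc k)) = binom2 (int k) + int k"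
  using binom2_add[of "int k" 1] by (simp add: add.commute)

lemma binom2_minus: "binom2 (- r) = binom2 r + r"
proof -
  have "2 * binom2 (- r) = 2 * (binom2 r + r)"
    by (simp only: distrib_left binom2_double) (simp add: algebra_simps)
  thus ?thesis by simp
qed

lemma binom2_one_minus: "binom2 (1 - r) = binom2 r"
  using binom2_add[of 1 "- r"] by (simp add: binom2_minus)

lemma binom2_of_nat: "binom2 (int k) = int (k choose 2)"
  by (induction k) (simp_all only: binom2_Suc, simp_all add: numeral_2_eq_2)

section \<open>Absolute convergence of theta series\<close>

lemma summable_on_int_split:
  fixes f :: "int \<Rightarrow> real"
  assumes "(\<lambda>k::nat. f (int k)) summable_on UNIV" and "(\<lambda>k::nat. f (- int k)) summable_on UNIV"
  shows "f summable_on UNIV"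
proof -
  have "f summable_on range int"
    using assms(1) by (subst summable_on_reindex) (auto simp: o_def)
  moreover have "f summable_on range (\<lambda>k. - int k)"
    using assms(2) by (subst summable_on_reindex) (auto simp: o_def inj_on_def)
  ultimately have "f summable_on (range int \<union> range (\<lambda>k. - int k))"
    by (rule summable_on_union)
  also have "range int \<union> range (\<lambda>k. - int k) = UNIV"
    by (auto intro: int_cases2)
  finally show ?thesis .
qed

text \<open>The ratio of consecutive terms is \<open>\<rho> ^ k * M\<close>, which tends to
  0.\<close>

lemma summable_on_theta_nat:
  fixes \<rho> M :: real
  assumes "0 < \<rho>" "\<rho> < 1" "0 < M"
  shows "(\<lambda>k::nat. \<rho> powi binom2 (int k) * M ^ k) summable_on UNIV"
proof -
  let ?f = "\<lambda>k::nat. \<rho> powi binom2 (int k) * M ^ k"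
  have "(\<lambda>k. \<rho> ^ k * M) \<longlonglongrightarrow> 0 * M"
    using assms by (intro tendsto_intros LIMSEQ_realpow_zero) auto
  hence "eventually (\<lambda>k. \<rho> ^ k * M < 1 / 2) sequentially"
    by (intro order_tendstoD) auto
  then obtain N where N: "\<rho> ^ k * M < 1 / 2" if "k \<ge> N" for k
    by (auto simp: eventually_at_top_linorder)
  have "summable ?f"
  proof (rule summable_ratio_test)
    fix k :: nat assume "k \<ge> N"
    have "?f (Suc k) = (\<rho> ^ k * M) * ?f k"
      using assms by (simp only: binom2_Suc) (simp add: power_int_add)
    also have "\<dots> \<le> 1 / 2 * ?f k"
      using N[OF \<open>k \<ge> N\<close>] assms by (intro mult_right_mono) auto
    finally show "norm (?f (Suc k)) \<le> 1 / 2 * norm (?f k)"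
      using assms by (simp del: of_nat_Suc)
  qed auto
  thus ?thesis
    using assms by (subst summable_on_UNIV_nonneg_real_iff) auto
qed

lemma summable_on_theta:
  fixes \<rho> M :: real
  assumes "0 < \<rho>" "\<rho> < 1" "0 < M"
  shows "(\<lambda>k. \<rho> powi binom2 k * M powi k) summable_on UNIV"
proof (rule summable_on_int_split)
  show "(\<lambda>k. \<rho> powi binom2 (int k) * M powi int k) summable_on UNIV"
    using summable_on_theta_nat[OF assms] by simp
  \<comment> \<open>Since \<open>binom2 (- k) = binom2 k + k\<close>, the negative half is again a
    theta series, with \<open>M\<close> replaced by \<open>\<rho> / M\<close>.\<close>
  have "(\<lambda>k. \<rho> powi binom2 (int k) * (\<rho> / M) ^ k) summable_on UNIV"
    using assms by (intro summable_on_theta_nat) auto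
  thus "(\<lambda>k. \<rho> powi binom2 (- int k) * M powi - int k) summable_on UNIV"
    using assms by (simp add: binom2_minus power_int_add power_divide power_int_minus field_simps)
qed

lemma norm_power_less_one:
  fixes q :: complex
  assumes "norm q < 1" "k > 0"
  shows "norm (q ^ k) < 1"
  using assms by (simp add: norm_power power_less_one_iff)

section \<open>The finite triple product\<close>

definition qpoch_fin :: "complex \<Rightarrow> nat \<Rightarrow> complex" where
  "qpoch_fin q N = (\<Prod>i<N. 1 - q * q ^ i)"

text \<open>Extending the reciprocal by zero to negative indices keeps the recurrence valid for all
  integers, so the finite triple product identity needs no boundary cases.\<close>

definition qpoch_recip :: "complex \<Rightarrow> int \<Rightarrow> complex" where
  "qpoch_recip q k = (if k < 0 then 0 else 1 / qpoch_fin q (nat k))"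

lemma power_neq_one:
  fixes q :: complex
  assumes "norm q < 1"
  shows "q * q ^ i \<noteq> 1"
proof
  assume "q * q ^ i = 1"
  hence "norm (q ^ Suc i) = 1" by simp
  moreover have "norm (q ^ Suc i) < 1"
    using assms by (cases "q = 0") (auto simp: norm_mult norm_power intro: power_Suc_less_one[simplified])
  ultimately show False by simp
qed

lemma qpoch_fin_nonzero: "norm q < 1 \<Longrightarrow> qpoch_fin q N \<noteq> 0"
  using power_neq_one[of q] by (auto simp: qpoch_fin_def)

lemma qpoch_recip_rec:
  assumes "norm q < 1"
  shows "qpoch_recip q (k - 1) = (1 - q powi k) * qpoch_recip q k"
proof -
  consider "k < 0" | "k = 0" | m where "k = int (Suc m)"
    by (metis int_cases3 not_less0 of_nat_0_less_iff old.nat.exhaust neg_less_0_iff_less)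
  thus ?thesis
  proof cases
    case 3
    show ?thesis
      using power_neq_one[OF assms, of m] qpoch_fin_nonzero[OF assms, of m] unfolding 3
      by (simp add: qpoch_recip_def qpoch_fin_def power_int_def nat_add_distrib field_simps)
  qed (auto simp: qpoch_recip_def)
qed

lemma convergent_prod_qpoch:
  fixes q x :: complex
  assumes "norm q < 1"
  shows "convergent_prod (\<lambda>k. 1 - x * q ^ k)"
proof -
  have "summable (\<lambda>k. norm (1 - x * q ^ k - 1))"
    using assms by (simp add: norm_mult norm_power summable_mult summable_geometric)
  thus ?thesis
    by (intro abs_convergent_prod_imp_convergent_prod summable_imp_abs_convergent_prod)
qed

lemma qpoch_inf_LIMSEQ:
  assumes "norm q < 1"
  shows "(\<lambda>N. \<Prod>k<N. 1 - x * q ^ k) \<longlonglongrightarrow> qpoch_inf x q"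
  using convergent_prod_LIMSEQ[OF convergent_prod_qpoch[OF assms, of x]]
  unfolding qpoch_inf_def by (simp add: LIMSEQ_lessThan_iff_atMost)

lemma qpoch_inf_nonzero:
  assumes "norm q < 1"
  shows "qpoch_inf q q \<noteq> 0"
  unfolding qpoch_inf_def
  using power_neq_one[OF assms] by (intro prodinf_nonzero convergent_prod_qpoch assms) auto

text \<open>A Gaussian binomial coefficient, \<open>2 * N\<close> over \<open>N + m\<close>, times a
  signed power of \<open>q\<close>. It vanishes for |m| > N by the convention in
  \<open>qpoch_recip\<close>.\<close>

definition jtp_coeff :: "complex \<Rightarrow> nat \<Rightarrow> int \<Rightarrow> complex" where
  "jtp_coeff q N m = (-1) powi m * q powi binom2 m *
     (qpoch_fin q (2 * N) * qpoch_recip q (int N + m) * qpoch_recip q (int N - m))"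

text \<open>This is the effect of the new factors
  \<open>(1 - x * q ^ N) * (1 - q / x * q ^ N)\<close> on the coefficient of
  \<open>x powi m\<close>. In terms of \<alpha> and \<beta>, whose product is
  \<open>q ^ (2 * N)\<close>, it becomes a polynomial identity.\<close>

lemma jtp_coeff_rec:
  assumes "norm q < 1" "q \<noteq> 0"
  shows "jtp_coeff q (Suc N) m = (1 + q ^ (2 * N + 1)) * jtp_coeff q N m
           - q ^ N * jtp_coeff q N (m - 1) - q ^ Suc N * jtp_coeff q N (m + 1)"
proof -
  define \<alpha> \<beta> where "\<alpha> = q powi (int N + m)" and "\<beta> = q powi (int N - m)"
  define u v w where "u = qpoch_recip q (int N + m + 1)" and "v = qpoch_recip q (int N - m + 1)"
    and "w = (-1) powi m * q powi binom2 m * qpoch_fin q (2 * N)"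
  have ab: "\<alpha> * \<beta> = q ^ (2 * N)"
    using assms by (simp add: \<alpha>_def \<beta>_def flip: power_int_add power_int_of_nat)
  have 1: "qpoch_recip q (int N + m) = (1 - q * \<alpha>) * u"
    using qpoch_recip_rec[OF assms(1), of "int N + m + 1"] assms
    by (simp add: u_def \<alpha>_def power_int_add mult_ac)
  have 2: "qpoch_recip q (int N - m) = (1 - q * \<beta>) * v"
    using qpoch_recip_rec[OF assms(1), of "int N - m + 1"] assms
    by (simp add: v_def \<beta>_def power_int_add power_int_diff mult_ac)
  have 3: "qpoch_recip q (int N + m - 1) = (1 - \<alpha>) * ((1 - q * \<alpha>) * u)"
    using qpoch_recip_rec[OF assms(1), of "int N + m"] 1 by (simp add: \<alpha>_def)
  have 4: "qpoch_recip q (int N - m - 1) = (1 - \<beta>) * ((1 - q * \<beta>) * v)"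
    using qpoch_recip_rec[OF assms(1), of "int N - m"] 2 by (simp add: \<beta>_def)
  have aux: "a * j = s * c * r" if "a * b = c" "j = s * b * r" for a b c j r s :: complex
    using that by auto
  have c0: "jtp_coeff q N m = w * ((1 - q * \<alpha>) * u) * ((1 - q * \<beta>) * v)"
    by (simp add: jtp_coeff_def w_def 1 2)
  have "binom2 (m - 1) = 1 - m + binom2 m"
    using binom2_add[of m "-1"] by simp
  hence "q ^ N * q powi binom2 (m - 1) = q * \<beta> * q powi binom2 m"
    using assms by (simp add: \<beta>_def power_int_add power_int_diff)
  moreover have "jtp_coeff q N (m - 1) = - ((-1) powi m) * q powi binom2 (m - 1) *
      (qpoch_fin q (2 * N) * ((1 - \<alpha>) * ((1 - q * \<alpha>) * u)) * v)"
    using 3 unfolding jtp_coeff_def v_def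
    by (simp add: power_int_diff diff_diff_eq2 add_diff_eq diff_add_eq[symmetric])
  ultimately have "q ^ N * jtp_coeff q N (m - 1) = - ((-1) powi m) * (q * \<beta> * q powi binom2 m) *
      (qpoch_fin q (2 * N) * ((1 - \<alpha>) * ((1 - q * \<alpha>) * u)) * v)"
    by (rule aux)
  hence cm: "q ^ N * jtp_coeff q N (m - 1) = - (w * q * \<beta> * ((1 - \<alpha>) * ((1 - q * \<alpha>) * u)) * v)"
    by (simp add: w_def mult_ac)
  have "binom2 (m + 1) = binom2 m + m"
    using binom2_add[of m 1] by simp
  hence "q ^ Suc N * q powi binom2 (m + 1) = q * \<alpha> * q powi binom2 m"
    using assms by (simp add: \<alpha>_def power_int_add)
  moreover have "jtp_coeff q N (m + 1) = - ((-1) powi m) * q powi binom2 (m + 1) *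
      (qpoch_fin q (2 * N) * u * ((1 - \<beta>) * ((1 - q * \<beta>) * v)))"
    using 4 unfolding jtp_coeff_def u_def
    by (simp add: power_int_add diff_diff_eq add.assoc[symmetric])
  ultimately have "q ^ Suc N * jtp_coeff q N (m + 1) = - ((-1) powi m) * (q * \<alpha> * q powi binom2 m) *
      (qpoch_fin q (2 * N) * u * ((1 - \<beta>) * ((1 - q * \<beta>) * v)))"
    by (rule aux)
  hence cp: "q ^ Suc N * jtp_coeff q N (m + 1) = - (w * q * \<alpha> * u * ((1 - \<beta>) * ((1 - q * \<beta>) * v)))"
    by (simp add: w_def mult_ac)
  have qf: "qpoch_fin q (2 * Suc N) = qpoch_fin q (2 * N) * (1 - q * (\<alpha> * \<beta>)) * (1 - q * q * (\<alpha> * \<beta>))"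
    unfolding ab by (simp add: qpoch_fin_def mult_ac)
  have idx: "int (Suc N) + m = int N + m + 1" "int (Suc N) - m = int N - m + 1"
    by simp_all
  have cs: "jtp_coeff q (Suc N) m = w * (1 - q * (\<alpha> * \<beta>)) * (1 - q * q * (\<alpha> * \<beta>)) * u * v"
    unfolding jtp_coeff_def w_def u_def v_def qf idx by (simp only: mult_ac)
  have t: "q ^ (2 * N + 1) = q * (\<alpha> * \<beta>)"
    by (simp add: ab)
  show ?thesis
    unfolding cs cp cm c0 t by (simp add: algebra_simps)
qed

lemma has_sum_shift:
  fixes f :: "int \<Rightarrow> 'a :: {comm_monoid_add, topological_space}"
  assumes "(f has_sum s) UNIV"
  shows "((\<lambda>k. f (k + d)) has_sum s) UNIV"
  using assms
  by (subst has_sum_reindex_bij_witness[of _ "\<lambda>k. k - d" "\<lambda>k. k + d" UNIV f]) auto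

text \<open>Summing over all integers instead of from -N to N lets the induction step shift the
  index both ways without boundary terms.\<close>

lemma finite_jacobi_triple_product:
  assumes "norm q < 1" "q \<noteq> 0" "x \<noteq> 0"
  shows "((\<lambda>m. jtp_coeff q N m * x powi m) has_sum
           ((\<Prod>k<N. 1 - x * q ^ k) * (\<Prod>k<N. 1 - q / x * q ^ k))) UNIV"
proof (induction N)
  case 0
  have "((\<lambda>m::int. jtp_coeff q 0 m * x powi m) has_sum 1) {0}"
    using has_sum_finite[of "{0::int}" "\<lambda>m. jtp_coeff q 0 m * x powi m"]
    by (simp add: jtp_coeff_def qpoch_recip_def qpoch_fin_def)
  also have "?this \<longleftrightarrow> ?case"
    by (simp, intro has_sum_cong_neutral) (auto simp: jtp_coeff_def qpoch_recip_def)
  finally show ?case .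
next
  case (Suc N)
  let ?f = "\<lambda>m. jtp_coeff q N m * x powi m"
  define P where "P = (\<Prod>k<N. 1 - x * q ^ k) * (\<Prod>k<N. 1 - q / x * q ^ k)"
  have *: "((\<lambda>m. (1 + q ^ (2 * N + 1)) * ?f m + (- (q ^ N) * x) * ?f (m + (- 1)) + (- (q ^ Suc N) / x) * ?f (m + 1))
    has_sum ((1 + q ^ (2 * N + 1)) * P + (- (q ^ N) * x) * P + (- (q ^ Suc N) / x) * P)) UNIV"
    using Suc unfolding P_def by (intro has_sum_add has_sum_cmult_right has_sum_shift)
  also have "(\<lambda>m. (1 + q ^ (2 * N + 1)) * ?f m + (- (q ^ N) * x) * ?f (m + (- 1)) + (- (q ^ Suc N) / x) * ?f (m + 1)) =
     (\<lambda>m. jtp_coeff q (Suc N) m * x powi m)"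
  proof
    fix m
    have "x powi (m + (-1)) = x powi m / x" "x powi (m + 1) = x powi m * x"
      using assms by (simp_all add: power_int_diff power_int_add)
    thus "(1 + q ^ (2 * N + 1)) * ?f m + (- (q ^ N) * x) * ?f (m + (- 1)) + (- (q ^ Suc N) / x) * ?f (m + 1) =
            jtp_coeff q (Suc N) m * x powi m"
      using assms unfolding jtp_coeff_rec[OF assms(1,2)] by (simp add: field_simps)
  qed
  also have "(1 + q ^ (2 * N + 1)) * P + (- (q ^ N) * x) * P + (- (q ^ Suc N) / x) * P =
     P * ((1 - x * q ^ N) * (1 - q / x * q ^ N))"
    using assms by (simp add: field_simps power_mult power2_eq_square)
  finally show ?case
    by (simp add: P_def mult_ac)
qed

section \<open>Passage to the infinite triple product\<close>

lemma qpoch_recip_LIMSEQ: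
  assumes "norm q < 1"
  shows "(\<lambda>N. qpoch_recip q (int N + m)) \<longlonglongrightarrow> 1 / qpoch_inf q q"
proof -
  have "filterlim (\<lambda>N. nat (int N + m)) at_top sequentially"
    by (rule filterlim_at_top_mono[OF filterlim_minus_const_nat_at_top[of "nat (-m)"]])
       (auto intro!: always_eventually)
  hence "(\<lambda>N. 1 / qpoch_fin q (nat (int N + m))) \<longlonglongrightarrow> 1 / qpoch_inf q q"
    using qpoch_inf_LIMSEQ[OF assms, of q] qpoch_inf_nonzero[OF assms] unfolding qpoch_fin_def
    by (intro tendsto_intros) (auto intro: filterlim_compose)
  moreover have "eventually (\<lambda>N. 1 / qpoch_fin q (nat (int N + m)) = qpoch_recip q (int N + m)) sequentially"
    using eventually_ge_at_top[of "nat (-m)"] by eventually_elim (auto simp: qpoch_recip_def)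
  ultimately show ?thesis
    by (rule Lim_transform_eventually)
qed

text \<open>Tannery's theorem is applied to the finite identity: as N grows, each term tends to
  \<open>1 / qpoch_inf q q\<close> times the corresponding theta term, and it is dominated by a
  constant multiple of that term, uniformly in N.\<close>

theorem jacobi_triple_product:
  assumes "norm q < 1" "q \<noteq> 0" "x \<noteq> 0"
  shows "((\<lambda>k. (-1) powi k * q powi binom2 k * x powi k) has_sum jtheta x q) UNIV"
proof -
  let ?f = "\<lambda>k. (-1) powi k * q powi binom2 k * x powi k"
  have f_norm: "norm (?f k) = norm q powi binom2 k * norm x powi k" for k
    by (simp add: norm_mult norm_power_int)
  have f_abs: "(\<lambda>k. norm (?f k)) summable_on UNIV"
    unfolding f_norm using assms by (intro summable_on_theta) auto
  have "Bseq (qpoch_fin q)"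
    using qpoch_inf_LIMSEQ[OF assms(1), of q] unfolding qpoch_fin_def
    by (intro convergent_imp_Bseq convergentI)
  then obtain C1 where C1: "norm (qpoch_fin q N) \<le> C1" for N
    by (auto simp: Bseq_def)
  have "Bseq (\<lambda>N. qpoch_recip q (int N + 0))"
    using qpoch_recip_LIMSEQ[OF assms(1), of 0] by (intro convergent_imp_Bseq convergentI)
  then obtain C2 where C2: "C2 > 0" "norm (qpoch_recip q (int N)) \<le> C2" for N
    by (auto simp: Bseq_def)
  have C2': "norm (qpoch_recip q k) \<le> C2" for k
    using C2(1) C2(2)[of "nat k"] by (cases "k < 0") (auto simp: qpoch_recip_def)
  have C1_nonneg: "C1 \<ge> 0"
    using C1[of 0] norm_ge_zero order_trans by blast
  define S where "S = infsum ?f UNIV"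
  \<comment> \<open>\<open>int_decode\<close> enumerates the integers and so turns the bilateral sum
    into a series over the naturals.\<close>
  define a where "a = (\<lambda>i N. jtp_coeff q N (int_decode i) * x powi int_decode i)"
  have nat_sum: "(\<lambda>i. g (int_decode i)) sums s" if "(g has_sum s) UNIV" for g :: "int \<Rightarrow> complex" and s
    using that has_sum_reindex_bij_betw[OF bij_int_decode, of g s] by (intro has_sum_imp_sums) simp
  have f_sum: "(?f has_sum S) UNIV"
    using abs_summable_summable[OF f_abs] by (simp add: S_def)
  have M: "summable (\<lambda>i. C1 * C2 * C2 * norm (?f (int_decode i)))"
    using f_abs summable_on_reindex_bij_betw[OF bij_int_decode, of "\<lambda>k. norm (?f k)"]
    by (intro summable_mult summable_on_imp_summable) simp
  have lim: "(\<lambda>N. a i N) \<longlonglongrightarrow> 1 / qpoch_inf q q * ?f (int_decode i)" for i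
  proof -
    have "(\<lambda>N. qpoch_fin q (2 * N)) \<longlonglongrightarrow> qpoch_inf q q"
      using LIMSEQ_subseq_LIMSEQ[OF qpoch_inf_LIMSEQ[OF assms(1), of q], of "\<lambda>N. 2 * N"]
      by (simp add: qpoch_fin_def[abs_def] o_def strict_mono_def)
    hence "(\<lambda>N. a i N) \<longlonglongrightarrow> (-1) powi int_decode i * q powi binom2 (int_decode i) *
         (qpoch_inf q q * (1 / qpoch_inf q q) * (1 / qpoch_inf q q)) * x powi int_decode i"
      unfolding a_def jtp_coeff_def
      using qpoch_recip_LIMSEQ[OF assms(1), of "int_decode i"]
            qpoch_recip_LIMSEQ[OF assms(1), of "- int_decode i"]
      by (intro tendsto_intros) auto
    thus ?thesis
      using qpoch_inf_nonzero[OF assms(1)] by (simp add: mult_ac)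
  qed
  have bound: "norm (a i N) \<le> C1 * C2 * C2 * norm (?f (int_decode i))" for i N
  proof -
    define k where "k = int_decode i"
    have "norm (a i N) = norm (qpoch_fin q (2 * N)) * norm (qpoch_recip q (int N + k)) *
            norm (qpoch_recip q (int N - k)) * norm (?f k)"
      by (simp add: a_def jtp_coeff_def norm_mult mult_ac flip: k_def)
    also have "\<dots> \<le> C1 * C2 * C2 * norm (?f k)"
      using C1 C2' C2(1) C1_nonneg by (intro mult_mono mult_nonneg_nonneg) auto
    finally show ?thesis by (simp add: k_def)
  qed
  have "(\<lambda>N. \<Sum>i. a i N) \<longlonglongrightarrow> (\<Sum>i. 1 / qpoch_inf q q * ?f (int_decode i))"
    using tannerys_theorem[of a, OF lim _ M] bound by (simp add: case_prod_unfold)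
  also have "(\<Sum>i. 1 / qpoch_inf q q * ?f (int_decode i)) = 1 / qpoch_inf q q * S"
    by (rule sums_unique[OF sums_mult[OF nat_sum[OF f_sum]], symmetric])
  also have "(\<lambda>N. \<Sum>i. a i N) = (\<lambda>N. (\<Prod>k<N. 1 - x * q ^ k) * (\<Prod>k<N. 1 - q / x * q ^ k))"
    unfolding a_def
    by (rule ext, rule sums_unique[OF nat_sum[OF finite_jacobi_triple_product[OF assms]], symmetric])
  finally have "1 / qpoch_inf q q * S = qpoch_inf x q * qpoch_inf (q / x) q"
    using tendsto_mult[OF qpoch_inf_LIMSEQ[OF assms(1), of x] qpoch_inf_LIMSEQ[OF assms(1), of "q / x"]]
    by (intro LIMSEQ_unique)
  hence "S = jtheta x q"
    using qpoch_inf_nonzero[OF assms(1)] by (simp add: jtheta_def field_simps)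
  thus ?thesis using f_sum by simp
qed

section \<open>Weighted sums over the triple index\<close>

definition hecke_expt :: "nat \<Rightarrow> int \<Rightarrow> int \<Rightarrow> int \<Rightarrow> int" where
  "hecke_expt n A B p =
     int n * binom2 (A + B) + A * B + int n * binom2 p + int n * p * (A - B - int n)"

text \<open>The \<open>p\<close>-th term of \<open>j(x\<^sup>n/y\<^sup>n; q\<^bsup>n(2n+1)\<^esup>)\<close> times the \<open>(r,s)\<close> term of
  \<open>f\<^bsub>n,n+1,n\<^esub>(x,y,q)\<close> (without \<open>sg(r)\<close>), where \<open>A = r + np\<close> and \<open>B = s - np\<close>.\<close>

definition hecke_term ::
  "nat \<Rightarrow> complex \<Rightarrow> complex \<Rightarrow> complex \<Rightarrow> int \<Rightarrow> int \<Rightarrow> int \<Rightarrow> complex" where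
  "hecke_term n x y q A B p =
     (-1) powi (A + B + p) * x powi A * y powi B * q powi hecke_expt n A B p"

text \<open>The cut-off \<open>c\<close> stays free because the two halves of \<open>g\<close> call
  for different values, 0 and \<open>2 * n - 1\<close>.\<close>

definition hecke_wt :: "nat \<Rightarrow> int \<Rightarrow> int \<Rightarrow> int \<Rightarrow> int \<Rightarrow> complex" where
  "hecke_wt n c A B p = of_bool (- B \<le> int n * p) - of_bool (A \<le> B + c)"

section \<open>Absolute convergence of the weighted sum\<close>

lemma summable_on_times_nonneg:
  fixes f :: "'a \<Rightarrow> real" and g :: "'b \<Rightarrow> real"
  assumes "f summable_on UNIV" "g summable_on UNIV" "\<And>a. f a \<ge> 0" "\<And>b. g b \<ge> 0"
  shows "(\<lambda>(a, b). f a * g b) summable_on UNIV"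
proof -
  have "(\<lambda>(a, b). f a * g b) summable_on (UNIV \<times> UNIV)"
  proof (rule summable_on_SigmaI)
    show "((\<lambda>b. case (a, b) of (a, b) \<Rightarrow> f a * g b) has_sum f a * infsum g UNIV) UNIV" for a
      using assms(2) by (auto intro!: has_sum_cmult_right)
    show "(\<lambda>a. f a * infsum g UNIV) summable_on UNIV"
      using assms(1) by (rule summable_on_cmult_left)
  qed (use assms in auto)
  thus ?thesis by simp
qed

text \<open>The exponent is an indefinite quadratic form, but splitting off the product
  \<open>(np + B)(A - B - c)\<close>, which is nonnegative wherever the weight is nonzero,
  leaves three separate one-dimensional theta exponents.\<close>

lemma hecke_expt_split:
  "hecke_expt n A B p = int n * binom2 (A + B) + (2 * binom2 B + (c + 1) * B) +
     (int n * binom2 p + (int n * c - int n * int n) * p) + (int n * p + B) * (A - B - c)"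
  unfolding hecke_expt_def binom2_double by (simp add: algebra_simps)

text \<open>The weight survives only where exactly one of its two conditions holds, and there both
  factors are nonnegative or both are nonpositive.\<close>

lemma hecke_wt_support: "hecke_wt n c A B p \<noteq> 0 \<Longrightarrow> (int n * p + B) * (A - B - c) \<ge> 0"
  by (auto simp: hecke_wt_def zero_le_mult_iff split: if_splits)

lemma norm_hecke_wt_le: "norm (hecke_wt n c A B p) \<le> 1"
  by (auto simp: hecke_wt_def)

text \<open>Dropping the nonnegative part of the exponent bounds each term by a product of theta
  terms in \<open>A + B\<close>, \<open>B\<close> and \<open>p\<close>. These three vary
  independently, because (A,B) \<mapsto> (A + B, B) is a bijection of pairs of integers.\<close>

lemma summable_on_hecke:
  assumes "norm q < 1" "q \<noteq> 0" "x \<noteq> 0" "y \<noteq> 0" "n > 0"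
  shows "(\<lambda>(B, A, p). hecke_wt n c A B p * hecke_term n x y q A B p) summable_on UNIV"
proof -
  define \<rho> X Y where "\<rho> = norm q" and "X = norm x" and "Y = norm y"
  have pos: "0 < \<rho>" "\<rho> < 1" "0 < X" "0 < Y"
    using assms by (auto simp: \<rho>_def X_def Y_def)
  define g1 where "g1 = (\<lambda>N. (\<rho> ^ n) powi binom2 N * X powi N)"
  define g2 where "g2 = (\<lambda>B. (\<rho> ^ 2) powi binom2 B * (\<rho> powi (c + 1) * (Y / X)) powi B)"
  define g3 where "g3 = (\<lambda>p. (\<rho> ^ n) powi binom2 p * (\<rho> powi (int n * c - int n * int n)) powi p)"
  have \<rho>n: "0 < \<rho> ^ k" "k > 0 \<Longrightarrow> \<rho> ^ k < 1" for k
    using pos by (auto simp: power_less_one_iff)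
  have g: "g1 summable_on UNIV" "g2 summable_on UNIV" "g3 summable_on UNIV"
    unfolding g1_def g2_def g3_def using assms(5) pos
    by (intro summable_on_theta \<rho>n; simp)+
  have g_nonneg: "g1 k \<ge> 0" "g2 k \<ge> 0" "g3 k \<ge> 0" for k
    using pos by (simp_all add: g1_def g2_def g3_def)
  have "(\<lambda>(N, B, p). g1 N * (case (B, p) of (B, p) \<Rightarrow> g2 B * g3 p)) summable_on UNIV"
    using summable_on_times_nonneg[OF g(1) summable_on_times_nonneg[OF g(2,3)]] g_nonneg
    by (auto simp: case_prod_unfold)
  also have "?this \<longleftrightarrow> (\<lambda>(B, A, p). g1 (A + B) * (g2 B * g3 p)) summable_on UNIV"
    by (rule summable_on_reindex_bij_witness[of _ "\<lambda>(B, A, p). (A + B, B, p)" "\<lambda>(N, B, p). (B, N - B, p)"])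
       auto
  finally have sum: "(\<lambda>(B, A, p). g1 (A + B) * (g2 B * g3 p)) summable_on UNIV" .
  have "norm (hecke_wt n c A B p * hecke_term n x y q A B p) \<le> g1 (A + B) * (g2 B * g3 p)" for A B p
  proof (cases "hecke_wt n c A B p = 0")
    case False
    define e where "e = int n * binom2 (A + B) + (2 * binom2 B + (c + 1) * B) +
      (int n * binom2 p + (int n * c - int n * int n) * p)"
    have "e \<le> hecke_expt n A B p"
      using hecke_wt_support[OF False] hecke_expt_split[of n A B p c] by (simp add: e_def)
    hence le: "\<rho> powi hecke_expt n A B p \<le> \<rho> powi e"
      using pos by (intro power_int_decreasing) auto
    have "norm (hecke_wt n c A B p * hecke_term n x y q A B p) \<le> norm (hecke_term n x y q A B p)"
      using norm_hecke_wt_le[of n c A B p] by (simp add: norm_mult mult_left_le_one_le)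
    also have "norm (hecke_term n x y q A B p) = X powi A * Y powi B * \<rho> powi hecke_expt n A B p"
      by (simp add: hecke_term_def norm_mult norm_power_int X_def Y_def \<rho>_def)
    also have "\<dots> \<le> X powi A * Y powi B * \<rho> powi e"
      using le pos by (intro mult_left_mono) auto
    also have "\<dots> = g1 (A + B) * (g2 B * g3 p)"
    proof -
      have "\<rho> powi e = (\<rho> ^ n) powi binom2 (A + B) * ((\<rho> ^ 2) powi binom2 B * (\<rho> powi (c + 1)) powi B) *
          ((\<rho> ^ n) powi binom2 p * (\<rho> powi (int n * c - int n * int n)) powi p)"
        unfolding e_def power_int_of_nat[symmetric] power_int_mult[symmetric] using pos
        by (simp add: power_int_add)
      moreover have "X powi A * Y powi B = X powi (A + B) * (Y / X) powi B"
        using pos by (simp add: power_int_add power_int_divide_distrib)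
      ultimately show ?thesis
        by (simp only: g1_def g2_def g3_def power_int_mult_distrib mult_ac)
    qed
    finally show ?thesis .
  qed (use g_nonneg in auto)
  hence "(\<lambda>z. norm ((\<lambda>(B, A, p). hecke_wt n c A B p * hecke_term n x y q A B p) z)) summable_on UNIV"
    by (intro Infinite_Sum.abs_summable_on_comparison_test'[OF sum]) auto
  thus ?thesis by (rule abs_summable_summable)
qed

section \<open>Sums over \<open>p\<close> alone and over \<open>A\<close> alone\<close>

lemma summable_on_hecke_term_p:
  assumes "norm q < 1" "q \<noteq> 0" "n > 0"
  shows "(\<lambda>p. hecke_term n x y q A B p) summable_on UNIV"
proof -
  define X where "X = q powi (int n * (A - B - int n))"
  have qn: "norm (q ^ n) < 1"
    using assms by (intro norm_power_less_one)
  have "(\<lambda>p. (-1) powi (A + B) * x powi A * y powi B * q powi (int n * binom2 (A + B) + A * B) *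
          ((-1) powi p * (q ^ n) powi binom2 p * X powi p)) summable_on UNIV"
    using jacobi_triple_product[OF qn, of X] assms
    by (intro summable_on_cmult_right has_sum_imp_summable) (auto simp: X_def)
  also have "(\<lambda>p. (-1) powi (A + B) * x powi A * y powi B * q powi (int n * binom2 (A + B) + A * B) *
          ((-1) powi p * (q ^ n) powi binom2 p * X powi p)) = (\<lambda>p. hecke_term n x y q A B p)"
  proof
    fix p
    have ex: "hecke_expt n A B p = int n * binom2 (A + B) + A * B + int n * binom2 p + int n * (A - B - int n) * p"
      by (simp add: hecke_expt_def)
    have "q powi hecke_expt n A B p = q powi (int n * binom2 (A + B) + A * B) * (q ^ n) powi binom2 p * X powi p"
      unfolding ex X_def power_int_of_nat[symmetric] power_int_mult[symmetric] using assms by (simp add: power_int_add)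
    thus "(-1) powi (A + B) * x powi A * y powi B * q powi (int n * binom2 (A + B) + A * B) *
          ((-1) powi p * (q ^ n) powi binom2 p * X powi p) = hecke_term n x y q A B p"
      by (simp add: hecke_term_def power_int_add mult_ac)
  qed
  finally show ?thesis .
qed

text \<open>The reflection p \<mapsto> 1 - 2D - p keeps the exponent, and it reverses the sign since
  1 - 2D is odd. The sum therefore equals its own negative.\<close>

lemma infsum_hecke_term_p: "(\<Sum>\<^sub>\<infinity>p. hecke_term n x y q A B p) = 0"
proof -
  define D where "D = A - B - int n"
  let ?S = "\<Sum>\<^sub>\<infinity>p. hecke_term n x y q A B p"
  have refl: "hecke_term n x y q A B (1 - 2 * D - p) = - hecke_term n x y q A B p" for p
  proof -
    have "2 * (binom2 (1 - 2 * D - p) + (1 - 2 * D - p) * D) = 2 * (binom2 p + p * D)"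
      by (simp only: distrib_left binom2_double) (simp add: algebra_simps)
    hence "int n * (binom2 (1 - 2 * D - p) + (1 - 2 * D - p) * D) = int n * (binom2 p + p * D)"
      by simp
    hence "hecke_expt n A B (1 - 2 * D - p) = hecke_expt n A B p"
      unfolding hecke_expt_def D_def[symmetric] by (simp add: algebra_simps)
    moreover have "(-1 :: complex) powi (A + B + (1 - 2 * D - p)) = - ((-1) powi (A + B + p))"
      by (auto simp: power_int_minus_left)
    ultimately show ?thesis
      by (simp add: hecke_term_def)
  qed
  have "?S = (\<Sum>\<^sub>\<infinity>p. - hecke_term n x y q A B p)"
    by (rule infsum_reindex_bij_witness[of _ "\<lambda>p. 1 - 2 * D - p" "\<lambda>p. 1 - 2 * D - p"]) (auto simp: refl)
  also have "\<dots> = - ?S"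
    by (rule infsum_uminus)
  finally show ?thesis by simp
qed

text \<open>With \<open>A = m + n * r\<close> the cross terms between \<open>m\<close> and
  \<open>r\<close> cancel in the exponent. The sum over \<open>m\<close> is the theta factor of the
  \<open>t\<close>-th term of \<open>g\<close>; the last factor is the numerator of the
  \<open>r\<close>-th summand of its Appell-Lerch sum.\<close>

lemma has_sum_hecke_term_A:
  assumes "norm q < 1" "q \<noteq> 0" "x \<noteq> 0" "y \<noteq> 0" "n > 0"
  shows "((\<lambda>A. hecke_term n x y q A (int t - int n * r) r) has_sum
     ((- y) ^ t * q ^ (n * (t choose 2)) * jtheta (q ^ ((n + 1) * t) * x) (q ^ n) *
      ((-1) powi r * (q ^ (n * (2 * n + 1))) powi binom2 r * (x ^ n / y ^ n) powi r))) UNIV"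
proof -
  define X where "X = q ^ ((n + 1) * t) * x"
  define K where "K = (- y) ^ t * q ^ (n * (t choose 2)) *
    ((-1) powi r * (q ^ (n * (2 * n + 1))) powi binom2 r * (x ^ n / y ^ n) powi r)"
  have qn: "norm (q ^ n) < 1"
    using assms by (intro norm_power_less_one)
  have "((\<lambda>m. K * ((-1) powi m * (q ^ n) powi binom2 m * X powi m)) has_sum (K * jtheta X (q ^ n))) UNIV"
    using assms qn by (intro has_sum_cmult_right jacobi_triple_product) (auto simp: X_def)
  hence "((\<lambda>m. K * ((-1) powi (m + (- int n * r)) * (q ^ n) powi binom2 (m + (- int n * r)) * X powi (m + (- int n * r))))
     has_sum (K * jtheta X (q ^ n))) UNIV"
    by (rule has_sum_shift)
  also have "(\<lambda>m. K * ((-1) powi (m + (- int n * r)) * (q ^ n) powi binom2 (m + (- int n * r)) * X powi (m + (- int n * r)))) =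
    (\<lambda>A. hecke_term n x y q A (int t - int n * r) r)"
  proof
    fix A
    define m where "m = A - int n * r"
    have A: "A = m + int n * r" "A + (- int n * r) = m" by (simp_all add: m_def)
    have "2 * hecke_expt n A (int t - int n * r) r =
       2 * (int n * binom2 (int t) + int n * (2 * int n + 1) * binom2 r + int n * binom2 m + (int n + 1) * int t * m)"
    proof -
      have "2 * hecke_expt n A (int t - int n * r) r =
        int n * (2 * binom2 (m + int t)) + 2 * ((m + int n * r) * (int t - int n * r)) + int n * (2 * binom2 r) +
        2 * (int n * r * (m - int t + 2 * (int n * r) - int n))"
        unfolding hecke_expt_def A(1) by (simp add: algebra_simps)
      also have "\<dots> = int n * (2 * binom2 (int t)) + int n * (2 * int n + 1) * (2 * binom2 r) + int n * (2 * binom2 m) + 2 * ((int n + 1) * int t * m)"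
        unfolding binom2_double by (simp add: algebra_simps)
      finally show ?thesis by (simp add: algebra_simps)
    qed
    hence ex: "hecke_expt n A (int t - int n * r) r =
       int (n * (t choose 2)) + int (n * (2 * n + 1)) * binom2 r + int n * binom2 m + int ((n + 1) * t) * m"
      by (simp add: binom2_of_nat algebra_simps)
    have sgn: "(-1 :: complex) powi (A + (int t - int n * r) + r) = (-1) ^ t * (-1) powi r * (-1) powi m"
      unfolding A(1) by (simp add: power_int_add)
    have x: "x powi A = x powi m * (x ^ n) powi r" and y: "y powi (int t - int n * r) = y ^ t / (y ^ n) powi r"
      unfolding A(1) using assms by (simp_all add: power_int_add power_int_diff power_int_mult)
    have q: "q powi hecke_expt n A (int t - int n * r) r =
       q ^ (n * (t choose 2)) * (q ^ (n * (2 * n + 1))) powi binom2 r * (q ^ n) powi binom2 m * (q ^ ((n + 1) * t)) powi m"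
      unfolding ex using assms by (simp only: power_int_add power_int_mult power_int_of_nat simp_thms)
    show "K * ((-1) powi (A + (- int n * r)) * (q ^ n) powi binom2 (A + (- int n * r)) * X powi (A + (- int n * r))) =
       hecke_term n x y q A (int t - int n * r) r"
      unfolding hecke_term_def sgn x y q A(2) K_def X_def power_minus[of y]
      by (simp only: power_int_mult_distrib power_int_divide_distrib times_divide_eq_left times_divide_eq_right mult_ac)
  qed
  finally show ?thesis
    by (simp add: K_def X_def mult_ac)
qed

section \<open>Telescoping on a slice of fixed \<open>B\<close>\<close>

text \<open>In the difference of the exponents everything containing \<open>A\<close> or
  \<open>p\<close> cancels, so the ratio is constant on a slice.\<close>

lemma hecke_term_shift:
  assumes "q \<noteq> 0" "x \<noteq> 0"
  shows "hecke_term n x y q (A - 1) B (p + 1) =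
           q powi (- (2 * int n + 1) * B - int n * int n) / x * hecke_term n x y q A B p"
proof -
  have b1: "binom2 (A - 1 + B) = binom2 (A + B) - (A + B) + 1"
    using binom2_add[of "A + B" "-1"] by (simp add: algebra_simps)
  have b2: "binom2 (p + 1) = binom2 p + p"
    using binom2_add[of p 1] by simp
  have ex: "hecke_expt n (A - 1) B (p + 1) = - (2 * int n + 1) * B - int n * int n + hecke_expt n A B p"
    unfolding hecke_expt_def b1 b2 by (simp add: algebra_simps)
  show ?thesis
    unfolding hecke_term_def ex using assms by (simp add: power_int_add power_int_diff mult_ac)
qed

lemma hecke_wt_diff:
  assumes "n > 0" "0 \<le> t" "t < int n"
  shows "hecke_wt n c A (t - int n * r) p - hecke_wt n c (A + 1) (t - int n * r) (p - 1) =
           of_bool (p = r) - of_bool (A = t - int n * r + c)"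
proof -
  \<comment> \<open>As 0 \<le> t < n, a multiple of n is at least nr - t exactly when it is at least
    nr.\<close>
  have "- (t - int n * r) \<le> int n * p \<longleftrightarrow> r \<le> p" for p
  proof
    assume "- (t - int n * r) \<le> int n * p"
    hence "int n * (r - p) < int n * 1"
      using assms by (simp add: algebra_simps)
    thus "r \<le> p"
      using assms by (subst (asm) mult_less_cancel_left_pos) auto
  next
    assume "r \<le> p"
    hence "int n * r \<le> int n * p" by (intro mult_left_mono) auto
    thus "- (t - int n * r) \<le> int n * p" using assms by linarith
  qed
  thus ?thesis
    unfolding hecke_wt_def by (auto simp: of_bool_def)
qed

lemma has_sum_diff_fun:
  fixes f g :: "'a \<Rightarrow> complex"
  assumes "(f has_sum a) A" "(g has_sum b) A"
  shows "((\<lambda>z. f z - g z) has_sum (a - b)) A"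
  using has_sum_add[OF assms(1) has_sum_cmult_right[OF assms(2), of "-1"]] by simp

text \<open>Below, \<open>g\<close> parametrizes one of the lines \<open>p = r\<close> and
  \<open>A = B + c\<close> in the plane of pairs (A,p).\<close>

lemma has_sum_of_bool:
  fixes f :: "'a \<Rightarrow> complex"
  assumes "(f has_sum s) UNIV" "inj g" "range g = {z. P z}" "\<And>k. h (g k) = f k"
  shows "((\<lambda>z. of_bool (P z) * h z) has_sum s) UNIV"
proof -
  have "(f has_sum s) UNIV \<longleftrightarrow> (h has_sum s) (range g)"
    using assms(2,4) by (subst has_sum_reindex) (auto simp: o_def)
  also have "\<dots> \<longleftrightarrow> ?thesis"
    using assms(3) by (intro has_sum_cong_neutral) auto
  finally show ?thesis using assms(1) by simp
qed

text \<open>The difference of the weights at \<open>(A,p)\<close> and \<open>(A+1,p-1)\<close> is \<open>[p = r] - [A = B + c]\<close>, and the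
  second indicator contributes a vanishing theta series.\<close>

lemma hecke_slice:
  assumes "norm q < 1" "q \<noteq> 0" "x \<noteq> 0" "y \<noteq> 0" "n > 0" "t < n"
    and B: "B = int t - int n * r"
    and u: "u = q powi (- (2 * int n + 1) * B - int n * int n) / x" "u \<noteq> 1"
  shows "(\<Sum>\<^sub>\<infinity>(A, p). hecke_wt n c A B p * hecke_term n x y q A B p) =
           (\<Sum>\<^sub>\<infinity>A. hecke_term n x y q A B r) / (1 - u)"
proof -
  let ?T = "\<lambda>A p. hecke_term n x y q A B p" and ?w = "\<lambda>A p. hecke_wt n c A B p"
  define S where "S = (\<Sum>\<^sub>\<infinity>(A, p). ?w A p * ?T A p)"
  have "(\<lambda>(B, z). case z of (A, p) \<Rightarrow> hecke_wt n c A B p * hecke_term n x y q A B p) summable_on (UNIV \<times> UNIV)"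
    using summable_on_hecke[OF assms(1-5), of c] by simp
  hence "(\<lambda>z. case z of (A, p) \<Rightarrow> ?w A p * ?T A p) summable_on UNIV"
    by (rule summable_on_SigmaD1) auto
  hence S: "((\<lambda>(A, p). ?w A p * ?T A p) has_sum S) UNIV"
    unfolding S_def by (rule has_sum_infsum)
  hence "((\<lambda>z. u * (case z of (A, p) \<Rightarrow> ?w A p * ?T A p)) has_sum (u * S)) UNIV"
    by (rule has_sum_cmult_right)
  \<comment> \<open>Multiplication by \<open>u\<close> moves each term to a neighbour; reindexing
    puts the terms back and shifts the weight instead.\<close>
  also have "?this \<longleftrightarrow> ((\<lambda>(A, p). ?w (A + 1) (p - 1) * ?T A p) has_sum (u * S)) UNIV"
    by (rule has_sum_reindex_bij_witness[of _ "\<lambda>(A, p). (A + 1, p - 1)" "\<lambda>(A, p). (A - 1, p + 1)"])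
       (auto simp: hecke_term_shift[OF assms(2,3)] u(1))
  finally have uS: "((\<lambda>(A, p). ?w (A + 1) (p - 1) * ?T A p) has_sum (u * S)) UNIV" .
  have "((\<lambda>z. (case z of (A, p) \<Rightarrow> ?w A p * ?T A p) - (case z of (A, p) \<Rightarrow> ?w (A + 1) (p - 1) * ?T A p))
          has_sum (S - u * S)) UNIV"
    using S uS by (rule has_sum_diff_fun)
  also have "(\<lambda>z. (case z of (A, p) \<Rightarrow> ?w A p * ?T A p) - (case z of (A, p) \<Rightarrow> ?w (A + 1) (p - 1) * ?T A p)) =
     (\<lambda>z. of_bool (snd z = r) * ?T (fst z) (snd z) - of_bool (fst z = B + c) * ?T (fst z) (snd z))"
    using hecke_wt_diff[OF assms(5), of "int t" c _ r] assms(6)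
    by (auto simp: fun_eq_iff B simp flip: left_diff_distrib)
  finally have D: "((\<lambda>z. of_bool (snd z = r) * ?T (fst z) (snd z) - of_bool (fst z = B + c) * ?T (fst z) (snd z))
     has_sum (S - u * S)) UNIV" .
  have "((\<lambda>A. ?T A r) has_sum (\<Sum>\<^sub>\<infinity>A. ?T A r)) UNIV"
    using has_sum_hecke_term_A[OF assms(1-5), of t r] unfolding B
    by (intro has_sum_infsum has_sum_imp_summable)
  hence D1: "((\<lambda>z. of_bool (snd z = r) * ?T (fst z) (snd z)) has_sum (\<Sum>\<^sub>\<infinity>A. ?T A r)) UNIV"
    by (rule has_sum_of_bool[where g = "\<lambda>A. (A, r)"]) (auto simp: inj_on_def)
  have "((\<lambda>p. ?T (B + c) p) has_sum 0) UNIV"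
    using has_sum_infsum[OF summable_on_hecke_term_p[OF assms(1,2,5), of x y "B + c" B]]
    by (simp add: infsum_hecke_term_p)
  hence D2: "((\<lambda>z. of_bool (fst z = B + c) * ?T (fst z) (snd z)) has_sum 0) UNIV"
    by (rule has_sum_of_bool[where g = "\<lambda>p. (B + c, p)"]) (auto simp: inj_on_def)
  have "S - u * S = (\<Sum>\<^sub>\<infinity>A. ?T A r) - 0"
    using has_sum_diff_fun[OF D1 D2] D by (rule has_sum_unique[rotated])
  thus ?thesis
    unfolding S_def[symmetric] using u(2) by (simp add: field_simps)
qed

section \<open>Identification with the Appell-Lerch sums\<close>

text \<open>The choice \<open>x ^ n / y ^ n\<close> reduces the powers of \<open>x\<close> and
  \<open>y\<close> in \<open>g_arg\<close> to \<open>1 / x\<close>. The denominator then depends on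
  \<open>t\<close> and \<open>r\<close> only through \<open>B = t - n * r\<close>, and it involves
  exactly the telescoping ratio.\<close>

lemma g_arg_times:
  assumes "q \<noteq> 0" "x \<noteq> 0" "y \<noteq> 0"
  shows "(q ^ (n * (2 * n + 1))) powi (r - 1) * g_arg n (n + 1) n x y q t * (x ^ n / y ^ n) =
           q powi (- (2 * int n + 1) * (int t - int n * r) - int n * int n) / x"
proof -
  have b: "int ((n + 1 + 1) choose 2) = int ((n + 1) choose 2) + (int n + 1)"
    by (simp add: numeral_2_eq_2)
  have ex: "int n * int ((n + 1 + 1) choose 2) - int n * int ((n + 1) choose 2)
        - int t * ((int (n + 1))\<^sup>2 - int n * int n) = int n * (int n + 1) - int t * (2 * int n + 1)"
    unfolding b by (simp add: algebra_simps power2_eq_square)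
  have aux: "- (a * b) * w = a / x" if "b * w = - (1 / x)" for a b w :: complex
    using that by (simp add: mult.assoc)
  have aux': "a * b * w = a * d / x" if "b * w = d / x" for a b d w :: complex
    using that by (simp add: mult.assoc)
  have "(- y) ^ n / (- x) ^ (n + 1) * (x ^ n / y ^ n) = - (1 / x)"
    using assms by (simp add: power_minus[of x] power_minus[of y] field_simps)
  hence "g_arg n (n + 1) n x y q t * (x ^ n / y ^ n) = q powi (int n * (int n + 1) - int t * (2 * int n + 1)) / x"
    unfolding g_arg_def ex by (rule aux)
  moreover have "(q ^ (n * (2 * n + 1))) powi (r - 1) = q powi (int (n * (2 * n + 1)) * (r - 1))"
    by (simp only: power_int_mult power_int_of_nat)
  ultimately have "(q ^ (n * (2 * n + 1))) powi (r - 1) * g_arg n (n + 1) n x y q t * (x ^ n / y ^ n) =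
     q powi (int (n * (2 * n + 1)) * (r - 1) + (int n * (int n + 1) - int t * (2 * int n + 1))) / x"
    unfolding power_int_add[OF disjI1[OF assms(1)]] by (simp only: aux')
  also have "int (n * (2 * n + 1)) * (r - 1) + (int n * (int n + 1) - int t * (2 * int n + 1)) =
     - (2 * int n + 1) * (int t - int n * r) - int n * int n"
    by (simp add: algebra_simps)
  finally show ?thesis .
qed

text \<open>Division with remainder by \<open>n\<close>: \<open>t\<close> is the remainder and
  \<open>- r\<close> the quotient.\<close>

lemma bij_betw_residue:
  assumes "n > 0"
  shows "bij_betw (\<lambda>(t, r). int t - int n * r) ({..<n} \<times> UNIV) UNIV"
proof (rule bij_betwI[where g = "\<lambda>B. (nat (B mod int n), - (B div int n))"])
  fix z assume z: "z \<in> {..<n} \<times> (UNIV :: int set)"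
  obtain t r where [simp]: "z = (t, r)" by (cases z)
  have "(int t - int n * r) mod int n = int t" "(int t - int n * r) div int n = - r"
    using z div_mult_self2[of "int n" "int t" "- r"] mod_mult_self2[of "int t" "int n" "- r"] by simp_all
  thus "(\<lambda>B. (nat (B mod int n), - (B div int n))) ((\<lambda>(t, r). int t - int n * r) z) = z"
    by simp
qed (use assms in \<open>auto simp: nat_less_iff\<close>)

text \<open>The sum is cut into slices of fixed \<open>B\<close>, indexed by \<open>t\<close> and
  \<open>r\<close>. Each slice is a theta factor times one Appell-Lerch summand, where genericity
  provides \<open>u \<noteq> 1\<close>; the factor \<open>jtheta z Q\<close> offsets the prefactor
  of \<open>appell_lerch\<close>.\<close>

lemma infsum_hecke:
  fixes q x y :: complex and n :: nat
  defines "Q \<equiv> q ^ (n * (2 * n + 1))" and "z \<equiv> x ^ n / y ^ n"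
  assumes "norm q < 1" "q \<noteq> 0" "x \<noteq> 0" "y \<noteq> 0" "n > 0"
    and no_pole: "\<And>t. t < n \<Longrightarrow> appell_lerch_no_pole (g_arg n (n + 1) n x y q t) Q z"
  shows "(\<Sum>\<^sub>\<infinity>(B, A, p). hecke_wt n c A B p * hecke_term n x y q A B p) =
     jtheta z Q * (\<Sum>t<n. (- y) ^ t * q ^ (n * (t choose 2)) * jtheta (q ^ ((n + 1) * t) * x) (q ^ n) *
        appell_lerch (g_arg n (n + 1) n x y q t) Q z)"
proof -
  let ?G = "\<lambda>B (A, p). hecke_wt n c A B p * hecke_term n x y q A B p"
  define F where "F = (\<lambda>B. \<Sum>\<^sub>\<infinity>w. ?G B w)"
  define C where "C = (\<lambda>t. (- y) ^ t * q ^ (n * (t choose 2)) * jtheta (q ^ ((n + 1) * t) * x) (q ^ n))"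
  have sumG: "(\<lambda>(B, w). ?G B w) summable_on (UNIV \<times> UNIV)"
    using summable_on_hecke[OF assms(3-7), of c] by simp
  have F_sum: "F summable_on UNIV"
    unfolding F_def by (rule summable_on_Sigma_banach[OF sumG])
  have slice: "F (int t - int n * r) =
     C t * ((-1) powi r * Q powi binom2 r * z powi r / (1 - Q powi (r - 1) * g_arg n (n + 1) n x y q t * z))"
    if "t < n" for t r
  proof -
    define u where "u = Q powi (r - 1) * g_arg n (n + 1) n x y q t * z"
    have "u \<noteq> 1"
      using no_pole[OF that] unfolding appell_lerch_no_pole_def u_def by auto
    moreover have "u = q powi (- (2 * int n + 1) * (int t - int n * r) - int n * int n) / x"
      unfolding u_def Q_def z_def using assms by (intro g_arg_times) auto
    ultimately have "F (int t - int n * r) = (\<Sum>\<^sub>\<infinity>A. hecke_term n x y q A (int t - int n * r) r) / (1 - u)"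
      unfolding F_def using assms that by (intro hecke_slice) auto
    also have "(\<Sum>\<^sub>\<infinity>A. hecke_term n x y q A (int t - int n * r) r) = C t * ((-1) powi r * Q powi binom2 r * z powi r)"
      unfolding C_def Q_def z_def using assms by (intro infsumI has_sum_hecke_term_A) auto
    finally show ?thesis by (simp add: u_def)
  qed
  have "(\<Sum>\<^sub>\<infinity>(B, A, p). hecke_wt n c A B p * hecke_term n x y q A B p) = infsum F UNIV"
    unfolding F_def using infsum_Sigma'_banach[OF sumG] by simp
  also have "\<dots> = (\<Sum>\<^sub>\<infinity>w\<in>{..<n} \<times> UNIV. F (case w of (t, r) \<Rightarrow> int t - int n * r))"
    by (rule infsum_reindex_bij_betw[OF bij_betw_residue[OF assms(7)], symmetric])
  also have "\<dots> = (\<Sum>\<^sub>\<infinity>t\<in>{..<n}. \<Sum>\<^sub>\<infinity>r. F (int t - int n * r))"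
    using summable_on_reindex_bij_betw[OF bij_betw_residue[OF assms(7)], of F] F_sum
    by (subst infsum_Sigma'_banach) (auto simp: case_prod_unfold)
  also have "\<dots> = (\<Sum>t<n. \<Sum>\<^sub>\<infinity>r. F (int t - int n * r))"
    by simp
  also have "\<dots> = (\<Sum>t<n. jtheta z Q * (C t * appell_lerch (g_arg n (n + 1) n x y q t) Q z))"
  proof (rule sum.cong)
    fix t assume "t \<in> {..<n}"
    hence t: "t < n" by simp
    have "jtheta z Q \<noteq> 0"
      using no_pole[OF t] by (simp add: appell_lerch_no_pole_def)
    thus "(\<Sum>\<^sub>\<infinity>r. F (int t - int n * r)) = jtheta z Q * (C t * appell_lerch (g_arg n (n + 1) n x y q t) Q z)"
      unfolding slice[OF t] infsum_cmult_right' appell_lerch_def by simp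
  qed simp
  finally show ?thesis
    unfolding C_def by (simp add: sum_distrib_left)
qed

section \<open>The symmetry between \<open>x\<close> and \<open>y\<close>, and the recovery of the
  Hecke-type sum\<close>

lemma jtheta_inverse:
  assumes "norm q < 1" "q \<noteq> 0" "x \<noteq> 0"
  shows "jtheta (1 / x) q = - (1 / x) * jtheta x q"
proof -
  have j: "jtheta z q = (\<Sum>\<^sub>\<infinity>k. (-1) powi k * q powi binom2 k * z powi k)" if "z \<noteq> 0" for z
    using infsumI[OF jacobi_triple_product[OF assms(1,2) that]] by simp
  have "jtheta (1 / x) q = (\<Sum>\<^sub>\<infinity>k. (-1) powi k * q powi binom2 k * (1 / x) powi k)"
    using assms by (intro j) auto
  also have "\<dots> = (\<Sum>\<^sub>\<infinity>k. - (1 / x) * ((-1) powi k * q powi binom2 k * x powi k))"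
    by (rule infsum_reindex_bij_witness[of _ "\<lambda>k. 1 - k" "\<lambda>k. 1 - k"])
       (use assms in \<open>auto simp: binom2_one_minus power_int_diff power_int_divide_distrib power_int_minus_left\<close>)
  also have "\<dots> = - (1 / x) * jtheta x q"
    unfolding infsum_cmult_right' j[OF assms(3)] ..
  finally show ?thesis .
qed

text \<open>Passing to \<open>B + n\<close> and \<open>A - n\<close> keeps the sum and adds
  \<open>n * (A - B - n)\<close> to the product; replacing \<open>p\<close> by \<open>1 - p\<close>
  takes this away again. The prefactor is the one in the inversion formula for the theta function at
  \<open>x ^ n / y ^ n\<close>.\<close>

lemma hecke_term_swap:
  assumes "x \<noteq> 0" "y \<noteq> 0"
  shows "hecke_term n y x q (B + int n) (A - int n) (1 - p) = - (y ^ n / x ^ n) * hecke_term n x y q A B p"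
proof -
  have ex: "hecke_expt n (B + int n) (A - int n) (1 - p) = hecke_expt n A B p"
    unfolding hecke_expt_def binom2_one_minus by (simp add: algebra_simps)
  have sgn: "(-1 :: complex) powi (B + int n + (A - int n) + (1 - p)) = - ((-1) powi (A + B + p))"
    by (auto simp: power_int_minus_left)
  show ?thesis
    unfolding hecke_term_def ex sgn using assms by (simp add: power_int_add power_int_diff)
qed

text \<open>In these coordinates \<open>p\<close> decouples from \<open>r\<close> and
  \<open>s\<close>, so the triple sum factors.\<close>

lemma hecke_term_diag:
  assumes "q \<noteq> 0" "x \<noteq> 0" "y \<noteq> 0"
  shows "hecke_term n x y q (r + int n * p) (s - int n * p) p =
    ((-1) powi p * (q ^ (n * (2 * n + 1))) powi binom2 p * (x ^ n / y ^ n) powi p) *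
    ((-1) powi (r + s) * x powi r * y powi s *
       q powi (int n * binom2 r + int (n + 1) * r * s + int n * binom2 s))"
proof -
  have "2 * hecke_expt n (r + int n * p) (s - int n * p) p =
     int n * (2 * binom2 (r + s)) + 2 * ((r + int n * p) * (s - int n * p)) + int n * (2 * binom2 p) +
     2 * (int n * p * (r - s + 2 * (int n * p) - int n))"
    unfolding hecke_expt_def by (simp add: algebra_simps)
  also have "\<dots> = int (n * (2 * n + 1)) * (2 * binom2 p) + int n * (2 * binom2 r) + 2 * (int (n + 1) * r * s) + int n * (2 * binom2 s)"
    unfolding binom2_double by (simp add: algebra_simps)
  finally have ex: "hecke_expt n (r + int n * p) (s - int n * p) p =
     int (n * (2 * n + 1)) * binom2 p + (int n * binom2 r + int (n + 1) * r * s + int n * binom2 s)"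
    by simp
  have q: "q powi hecke_expt n (r + int n * p) (s - int n * p) p = (q ^ (n * (2 * n + 1))) powi binom2 p *
     q powi (int n * binom2 r + int (n + 1) * r * s + int n * binom2 s)"
    unfolding ex power_int_add[OF disjI1[OF assms(1)], of "int (n * (2 * n + 1)) * binom2 p"]
    by (simp only: power_int_mult power_int_of_nat)
  have x: "x powi (r + int n * p) = x powi r * (x ^ n) powi p" and y: "y powi (s - int n * p) = y powi s / (y ^ n) powi p"
    using assms by (simp_all add: power_int_add power_int_diff power_int_mult)
  have sgn: "(-1 :: complex) powi (r + int n * p + (s - int n * p) + p) = (-1) powi p * (-1) powi (r + s)"
    by (simp add: power_int_add)
  show ?thesis
    unfolding hecke_term_def q x y sgn
    by (simp only: power_int_mult_distrib power_int_divide_distrib times_divide_eq_left times_divide_eq_right mult_ac)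
qed

text \<open>Half-plane indicators replace the condition on signs, so that each half of
  \<open>g\<close> can supply one of them.\<close>

lemma sg_weight:
  "of_bool (0 \<le> s) + of_bool (0 \<le> r) - 1 = (if sg r = sg s then of_int (sg r) else (0 :: complex))"
  by (auto simp: sg_def)

text \<open>The assumed summability justifies the iterated sum; it will come from adding the two
  halves of \<open>g\<close>.\<close>

lemma infsum_hecke_f:
  assumes "norm q < 1" "q \<noteq> 0" "x \<noteq> 0" "y \<noteq> 0" "n > 0"
    and sum: "(\<lambda>(B, A, p). (of_bool (- B \<le> int n * p) + of_bool (int n * p \<le> A) - 1) * hecke_term n x y q A B p)
            summable_on UNIV"
  shows "(\<Sum>\<^sub>\<infinity>(B, A, p). (of_bool (- B \<le> int n * p) + of_bool (int n * p \<le> A) - 1) * hecke_term n x y q A B p) =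
     jtheta (x ^ n / y ^ n) (q ^ (n * (2 * n + 1))) * hecke_f n (n + 1) n x y q"
proof -
  let ?K = "\<lambda>p. (-1) powi p * (q ^ (n * (2 * n + 1))) powi binom2 p * (x ^ n / y ^ n) powi p"
  let ?h = "\<lambda>r s. (-1) powi (r + s) * x powi r * y powi s *
       q powi (int n * binom2 r + int (n + 1) * r * s + int n * binom2 s)"
  let ?W = "\<lambda>(B, A, p). (of_bool (- B \<le> int n * p) + of_bool (int n * p \<le> A) - 1) * hecke_term n x y q A B p"
  let ?V = "\<lambda>(r, s). (of_bool (0 \<le> s) + of_bool (0 \<le> r) - 1) * ?h r s"
  let ?i = "\<lambda>(p, r, s). (s - int n * p, r + int n * p, p)"
  let ?j = "\<lambda>(B, A, p). (p, A - int n * p, B + int n * p)"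
  have bij: "bij_betw ?i UNIV UNIV"
    by (rule bij_betwI[where g = ?j]) auto
  have WV: "?W (?i (p, w)) = ?K p * ?V w" for p w
  proof -
    obtain r s where w: "w = (r, s)" by (cases w)
    have iff: "- (s - int n * p) \<le> int n * p \<longleftrightarrow> 0 \<le> s" "int n * p \<le> r + int n * p \<longleftrightarrow> 0 \<le> r"
      by auto
    show ?thesis
      unfolding w prod.case iff hecke_term_diag[OF assms(2-4)] by (simp only: mult_ac)
  qed
  have WV_fun: "(\<lambda>z. ?W (?i z)) = (\<lambda>(p, w). ?K p * ?V w)"
  proof
    fix z :: "int \<times> int \<times> int"
    obtain p w where z: "z = (p, w)" by (cases z)
    show "?W (?i z) = (case z of (p, w) \<Rightarrow> ?K p * ?V w)"
      unfolding z WV by (rule prod.case[symmetric])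
  qed
  have qn: "norm (q ^ (n * (2 * n + 1))) < 1"
    using assms by (intro norm_power_less_one) auto
  have f: "hecke_f n (n + 1) n x y q = infsum ?V UNIV"
    unfolding hecke_f_def by (rule infsum_cong_neutral) (auto simp: sg_weight mult_ac)
  have sum': "(\<lambda>(p, w). ?K p * ?V w) summable_on (UNIV \<times> UNIV)"
    using iffD2[OF summable_on_reindex_bij_betw[OF bij] sum] unfolding WV_fun UNIV_Times_UNIV .
  have "infsum ?W UNIV = (\<Sum>\<^sub>\<infinity>z. ?W (?i z))"
    by (rule infsum_reindex_bij_betw[OF bij, symmetric])
  also have "\<dots> = (\<Sum>\<^sub>\<infinity>(p, w)\<in>UNIV \<times> UNIV. ?K p * ?V w)"
    unfolding WV_fun UNIV_Times_UNIV ..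
  also have "\<dots> = (\<Sum>\<^sub>\<infinity>p. \<Sum>\<^sub>\<infinity>w. ?K p * ?V w)"
    using infsum_Sigma'_banach[OF sum'] by simp
  also have "\<dots> = (\<Sum>\<^sub>\<infinity>p. ?K p) * infsum ?V UNIV"
    by (simp only: infsum_cmult_right' infsum_cmult_left')
  also have "(\<Sum>\<^sub>\<infinity>p. ?K p) = jtheta (x ^ n / y ^ n) (q ^ (n * (2 * n + 1)))"
    using assms by (intro infsumI jacobi_triple_product[OF qn]) auto
  finally show ?thesis unfolding f .
qed

section \<open>Adding the two halves of \<open>g\<close>\<close>

theorem theorem0p9:
  fixes q x y :: complex and n :: nat
  assumes "0 < norm q" and "norm q < 1"
    and "n > 0"
    and "x \<noteq> 0" and "y \<noteq> 0"
    and "appell_g_generic n (n + 1) n x y q (y ^ n / x ^ n) (x ^ n / y ^ n)"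
  shows "hecke_f n (n + 1) n x y q = appell_g n (n + 1) n x y q (y ^ n / x ^ n) (x ^ n / y ^ n)"
proof -
  have q: "norm q < 1" "q \<noteq> 0"
    using assms by auto
  define Q z0 z1 where "Q = q ^ (n * (2 * n + 1))" and "z0 = x ^ n / y ^ n" and "z1 = y ^ n / x ^ n"
  have "int n * ((int (n + 1))\<^sup>2 - int n * int n) = int (n * (2 * n + 1))"
    by (simp add: power2_eq_square algebra_simps)
  hence Q: "q powi (int n * ((int (n + 1))\<^sup>2 - int n * int n)) = Q"
    unfolding Q_def by (simp only: power_int_of_nat)
  have pole1: "appell_lerch_no_pole (g_arg n (n + 1) n x y q t) Q z0"
    and pole2: "appell_lerch_no_pole (g_arg n (n + 1) n y x q t) Q z1" if "t < n" for t
    using assms(6) that unfolding appell_g_generic_def Q z0_def z1_def by blast+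
  have j0: "jtheta z0 Q \<noteq> 0"
    using pole1[OF assms(3)] by (simp add: appell_lerch_no_pole_def)
  define G1 where "G1 = (\<Sum>t<n. (- y) ^ t * q ^ (n * (t choose 2)) * jtheta (q ^ ((n + 1) * t) * x) (q ^ n) *
        appell_lerch (g_arg n (n + 1) n x y q t) Q z0)"
  define G2 where "G2 = (\<Sum>t<n. (- x) ^ t * q ^ (n * (t choose 2)) * jtheta (q ^ ((n + 1) * t) * y) (q ^ n) *
        appell_lerch (g_arg n (n + 1) n y x q t) Q z1)"
  have g: "appell_g n (n + 1) n x y q z1 z0 = G1 + G2"
    unfolding appell_g_def Q G1_def G2_def ..
  let ?T = "hecke_term n x y q"
  have "((\<lambda>(B, A, p). hecke_wt n 0 A B p * ?T A B p) has_sum jtheta z0 Q * G1) UNIV"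
    using has_sum_infsum[OF summable_on_hecke[OF q assms(4,5,3), of 0]]
      infsum_hecke[OF q assms(4,5,3), of 0] pole1
    unfolding G1_def Q_def z0_def by simp
  moreover have "((\<lambda>(B, A, p). (of_bool (int n * p \<le> A) - of_bool (B < A)) * ?T A B p) has_sum jtheta z0 Q * G2) UNIV"
  proof -
    have nz: "z1 \<noteq> 0" using assms by (simp add: z1_def)
    have qn: "norm Q < 1"
      using assms unfolding Q_def by (intro norm_power_less_one) auto
    have "z1 = 1 / z0" by (simp add: z0_def z1_def)
    hence j1: "jtheta z1 Q = - z1 * jtheta z0 Q"
      using jtheta_inverse[OF qn, of z0] q assms by (simp add: Q_def z0_def)
    \<comment> \<open>The cut-off \<open>2 * n - 1\<close> is chosen so that the swap turns
      \<open>A \<le> B + c\<close> into the strict inequality \<open>B < A\<close>.\<close>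
    have "((\<lambda>(B, A, p). hecke_wt n (2 * int n - 1) A B p * hecke_term n y x q A B p) has_sum jtheta z1 Q * G2) UNIV"
      using has_sum_infsum[OF summable_on_hecke[OF q assms(5,4,3), of "2 * int n - 1"]]
        infsum_hecke[OF q assms(5,4,3), of "2 * int n - 1"] pole2
      unfolding G2_def Q_def z1_def by simp
    also have "?this \<longleftrightarrow> ((\<lambda>(B, A, p). - z1 * ((of_bool (int n * p \<le> A) - of_bool (B < A)) * ?T A B p))
        has_sum jtheta z1 Q * G2) UNIV"
    proof (rule has_sum_reindex_bij_witness[of _ "\<lambda>(B, A, p). (A - int n, B + int n, 1 - p)"
          "\<lambda>(B, A, p). (A - int n, B + int n, 1 - p)"], goal_cases)
      case (5 w)
      obtain B A p where w: "w = (B, A, p)" by (cases w)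
      have "hecke_term n y x q A B p = - z1 * ?T (B + int n) (A - int n) (1 - p)"
        using hecke_term_swap[OF assms(4,5), of n q "A - int n" "B + int n" "1 - p"] by (simp add: z1_def)
      moreover have "hecke_wt n (2 * int n - 1) A B p = of_bool (int n * (1 - p) \<le> B + int n) - of_bool (A - int n < B + int n)"
        by (auto simp: hecke_wt_def algebra_simps)
      ultimately show ?case by (simp add: w mult_ac)
    qed auto
    also have "(\<lambda>(B, A, p). - z1 * ((of_bool (int n * p \<le> A) - of_bool (B < A)) * ?T A B p)) =
      (\<lambda>w. - z1 * (case w of (B, A, p) \<Rightarrow> (of_bool (int n * p \<le> A) - of_bool (B < A)) * ?T A B p))"
      by auto
    \<comment> \<open>The factor \<open>- z1\<close> from the swapped terms cancels against the one
      relating \<open>jtheta z1 Q\<close> to \<open>jtheta z0 Q\<close>.\<close>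
    finally show ?thesis
      unfolding j1 mult.assoc using nz by (subst (asm) has_sum_cmult_right_iff) auto
  qed
  ultimately have "((\<lambda>w. (case w of (B, A, p) \<Rightarrow> hecke_wt n 0 A B p * ?T A B p) +
      (case w of (B, A, p) \<Rightarrow> (of_bool (int n * p \<le> A) - of_bool (B < A)) * ?T A B p))
      has_sum (jtheta z0 Q * G1 + jtheta z0 Q * G2)) UNIV"
    by (rule has_sum_add)
  \<comment> \<open>The conditions \<open>A \<le> B\<close> and \<open>B < A\<close> are
    complementary, so the two subtracted indicators add up to 1.\<close>
  also have "(\<lambda>w. (case w of (B, A, p) \<Rightarrow> hecke_wt n 0 A B p * ?T A B p) +
      (case w of (B, A, p) \<Rightarrow> (of_bool (int n * p \<le> A) - of_bool (B < A)) * ?T A B p)) =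
      (\<lambda>(B, A, p). (of_bool (- B \<le> int n * p) + of_bool (int n * p \<le> A) - 1) * ?T A B p)"
    by (auto simp: fun_eq_iff hecke_wt_def simp flip: distrib_right)
  finally have H: "((\<lambda>(B, A, p). (of_bool (- B \<le> int n * p) + of_bool (int n * p \<le> A) - 1) * ?T A B p)
      has_sum (jtheta z0 Q * G1 + jtheta z0 Q * G2)) UNIV" .
  have "jtheta z0 Q * hecke_f n (n + 1) n x y q = jtheta z0 Q * (G1 + G2)"
    using infsum_hecke_f[OF q assms(4,5,3) has_sum_imp_summable[OF H]] infsumI[OF H]
    by (simp add: z0_def Q_def distrib_left)
  thus ?thesis
    using j0 g by (simp add: z0_def z1_def)
qed

end
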